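(* Fix a positive integer $k$. For an integer $n\ge 0$, let $R_k(n)$ denote the number of partitions of $n$ whose Durfee triangle has size $k$. Then, as $n\to\infty$, \[ R_k(n)=\frac{2^k}{k!}\,\frac{n^{k-1}}{(k-1)!}+O(n^{k-2}). \]
   Context: A partition of $n\ge 0$ is a tuple $\lambda=(\lambda_1,\dots,\lambda_d)$ of integers $\lambda_1\ge\cdots\ge\lambda_d\ge 1$ with sum $n$; set $\lambda_j=0$ for $j>d$. The Durfee triangle of $\lambda$ has size $k$ if $k$ is the largest integer such that $\lambda_j>k-j$ for all $j\in\{1,2,\dots,k\}$. *)

theory Defs
  imports Complex_Main "HOL-Library.Landau_Symbols"
begin

definition partitions :: "nat \<Rightarrow> nat list set" where
  "partitions n = {xs. sorted_wrt (\<ge>) xs \<and> (\<forall>x\<in>set xs. x \<ge> 1) \<and> sum_list xs = n}"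

text \<open>Parts are indexed from 1 and padded with zeros.\<close>

definition part :: "nat list \<Rightarrow> nat \<Rightarrow> nat" where
  "part xs j = (if 1 \<le> j \<and> j \<le> length xs then xs ! (j - 1) else 0)"

definition fits_triangle :: "nat list \<Rightarrow> nat \<Rightarrow> bool" where
  "fits_triangle xs k \<longleftrightarrow> (\<forall>j\<in>{1..k}. part xs j > k - j)"

definition durfee_triangle_size :: "nat list \<Rightarrow> nat" where
  "durfee_triangle_size xs = (GREATEST k. fits_triangle xs k)"

definition R :: "nat \<Rightarrow> nat \<Rightarrow> nat" where
  "R k n = card {xs \<in> partitions n. durfee_triangle_size xs = k}"

text \<open>The maximum and the cardinality above are not taken over unbounded or infinite sets.\<close>

lemma fits_triangle_le_length: "fits_triangle xs k \<Longrightarrow> k \<le> length xs"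
  by (cases k) (force simp: fits_triangle_def part_def split: if_splits)+

lemma durfee_triangle_size_eq_iff:
  "durfee_triangle_size xs = k \<longleftrightarrow>
     fits_triangle xs k \<and> (\<forall>m. fits_triangle xs m \<longrightarrow> m \<le> k)"
proof -
  have "fits_triangle xs 0" by (simp add: fits_triangle_def)
  then have "fits_triangle xs (durfee_triangle_size xs)"
    unfolding durfee_triangle_size_def
    by (rule GreatestI_nat) (rule fits_triangle_le_length)
  moreover have "m \<le> durfee_triangle_size xs" if "fits_triangle xs m" for m
    unfolding durfee_triangle_size_def using that
    by (rule Greatest_le_nat) (rule fits_triangle_le_length)
  ultimately show ?thesis by (auto intro: antisym)
qed

lemma finite_partitions: "finite (partitions n)"
proof (rule finite_subset)
  show "partitions n \<subseteq> {xs. set xs \<subseteq> {..n} \<and> length xs \<le> n}"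
  proof
    fix xs assume xs: "xs \<in> partitions n"
    have "length ys \<le> sum_list ys" if "\<forall>x\<in>set ys. (x::nat) \<ge> 1" for ys
      using that by (induction ys) auto
    with xs show "xs \<in> {xs. set xs \<subseteq> {..n} \<and> length xs \<le> n}"
      by (auto simp: partitions_def dest: member_le_sum_list)
  qed
qed (rule finite_lists_length_le, simp)

end

theory Submission
  imports Defs
begin

text \<open>
  If \<open>\<lambda>\<close> has a Durfee triangle of size \<open>k\<close>, let \<open>a\<close> be minimal with \<open>\<lambda>\<^bsub>a+1\<^esub> \<le> k - a\<close>
  and put \<open>b = k - a\<close>. Then \<open>\<lambda>\<close> consists of an \<open>a \<times> b\<close> rectangle, \<open>a\<close> row arms to its right
  and \<open>b\<close> column arms below it. Recording the differences of the row arms and the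
  multiplicities of the parts below the rectangle, \<open>\<lambda>\<close> becomes a solution of
  \<open>\<Sum>i\<le>a. i x\<^sub>i + \<Sum>j\<le>b. j y\<^sub>j = n - a b\<close> in natural numbers; conversely every solution with
  all unknowns at least 2 occurs. The number of solutions of such an equation with right-hand
  side \<open>m\<close> is \<open>m\<^bsup>k-1\<^esup> / ((k-1)! a! b!) + O(m\<^bsup>k-2\<^esup>)\<close>, bounded shifts of \<open>m\<close> do not affect this,
  and the sum of \<open>1 / (a! b!)\<close> over \<open>a + b = k\<close> is \<open>2\<^sup>k / k!\<close>.
\<close>

section \<open>Weighted sums\<close>

fun wsum :: "nat list \<Rightarrow> nat" where
  "wsum [] = 0"
| "wsum (x # xs) = x * Suc (length xs) + wsum xs"

text \<open>The unknowns are listed in order of decreasing weight: \<open>rows\<close> turns differences, starting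
  with the smallest row, into a decreasing sequence, and \<open>cols\<close> turns multiplicities,
  starting with that of the largest part, into a partition.\<close>

fun rows :: "nat list \<Rightarrow> nat list" where
  "rows [] = []"
| "rows (x # xs) = map (\<lambda>i. i + x) (rows xs @ [0])"

fun cols :: "nat list \<Rightarrow> nat list" where
  "cols [] = []"
| "cols (y # ys) = replicate y (Suc (length ys)) @ cols ys"

text \<open>The cardinality is the coefficient of \<open>q^m\<close> in the product of all
  \<open>1/(1 - q^i)\<close>, \<open>i\<close> from 1 to \<open>a\<close>, and all
  \<open>1/(1 - q^j)\<close>, \<open>j\<close> from 1 to \<open>b\<close>.\<close>

definition wpairs :: "nat \<Rightarrow> nat \<Rightarrow> nat \<Rightarrow> (nat list \<times> nat list) set" where
  "wpairs a b m = {(x, y). length x = a \<and> length y = b \<and> wsum x + wsum y = m}"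

section \<open>Power sums along arithmetic progressions\<close>

text \<open>The quotient of the difference of powers by \<open>x - y\<close> is a sum of
  \<open>Suc r\<close> monomials of degree \<open>r\<close>, each between \<open>y ^ r\<close> and
  \<open>x ^ r\<close>.\<close>

lemma power_diff_bounds:
  fixes x y :: real
  assumes "0 \<le> y" "y \<le> x"
  shows "real (Suc r) * (x - y) * y ^ r \<le> x ^ Suc r - y ^ Suc r"
    and "x ^ Suc r - y ^ Suc r \<le> real (Suc r) * (x - y) * x ^ r"
proof -
  have "real (Suc r) * (x - y) * y ^ r \<le> x ^ Suc r - y ^ Suc r \<and>
        x ^ Suc r - y ^ Suc r \<le> real (Suc r) * (x - y) * x ^ r"
  proof (induction r)
    case (Suc r)
    have p: "(x - y) * y ^ Suc r \<le> (x - y) * x ^ Suc r"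
      using assms by (intro mult_left_mono power_mono) auto
    have "y * (real (Suc r) * (x - y) * y ^ r) \<le> y * (x ^ Suc r - y ^ Suc r)"
      using Suc.IH assms by (intro mult_left_mono) auto
    moreover have "x * (x ^ Suc r - y ^ Suc r) \<le> x * (real (Suc r) * (x - y) * x ^ r)"
      using Suc.IH assms by (intro mult_left_mono) auto
    ultimately show ?case using p by (simp add: algebra_simps)
  qed auto
  then show "real (Suc r) * (x - y) * y ^ r \<le> x ^ Suc r - y ^ Suc r"
    and "x ^ Suc r - y ^ Suc r \<le> real (Suc r) * (x - y) * x ^ r" by auto
qed

text \<open>\<open>D m\<close> is the excess of a Riemann sum of mesh \<open>w\<close> over the
  integral of \<open>t^r / w\<close> from 0 to \<open>m\<close>. Passing from \<open>m - w\<close>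
  to \<open>m\<close> raises it by an amount between 0 and \<open>m^r - (m - w)^r\<close>, and these
  bounds telescope.\<close>

lemma arith_progression_power_sum_bounds:
  fixes w r m :: nat
  assumes w: "w \<ge> 1"
  defines "D \<equiv> (\<lambda>m. (\<Sum>t\<le>m div w. real (m - w * t) ^ r) - real m ^ Suc r / (real w * real (Suc r)))"
  shows "0 \<le> D m" and "D m \<le> real m ^ r"
proof -
  have "0 \<le> D m \<and> D m \<le> real m ^ r"
  proof (induction m rule: less_induct)
    case (less m)
    show ?case
    proof (cases "m < w")
      case True
      \<comment> \<open>Only the term \<open>t = 0\<close> occurs here, so \<open>D m\<close> is
        \<open>m^r\<close> times one minus this quotient.\<close>
      have "real m / (real w * real (Suc r)) \<le> 1"
      proof -
        have "real m \<le> real w * 1" using True by simp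
        also have "\<dots> \<le> real w * real (Suc r)" by (intro mult_left_mono) auto
        finally show ?thesis using w by (simp add: divide_le_eq)
      qed
      then have "real m ^ r * (real m / (real w * real (Suc r))) \<le> real m ^ r * 1"
        by (intro mult_left_mono) auto
      then have "real m ^ Suc r / (real w * real (Suc r)) \<le> real m ^ r"
        by (simp add: mult.commute)
      moreover have "real m ^ Suc r / (real w * real (Suc r)) \<ge> 0" by simp
      moreover have "D m = real m ^ r - real m ^ Suc r / (real w * real (Suc r))"
        using True by (simp add: D_def)
      ultimately show ?thesis by linarith
    next
      case False
      then have m: "m div w = Suc ((m - w) div w)" using w by (simp add: le_div_geq)
      have "(\<Sum>t\<le>m div w. real (m - w * t) ^ r)
          = real m ^ r + (\<Sum>t\<le>(m - w) div w. real ((m - w) - w * t) ^ r)"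
        by (simp only: m sum.atMost_Suc_shift) (simp add: diff_diff_eq)
      then have D: "D m = D (m - w) + real m ^ r
          - (real m ^ Suc r - real (m - w) ^ Suc r) / (real w * real (Suc r))"
        by (simp add: D_def diff_divide_distrib)
      have pos: "0 < real w * real (Suc r)" using w by simp
      have mw: "real m - real (m - w) = real w" using False by (simp add: of_nat_diff)
      note b = power_diff_bounds[of "real (m - w)" "real m" r, unfolded mw]
      have "real (m - w) ^ r \<le> (real m ^ Suc r - real (m - w) ^ Suc r) / (real w * real (Suc r))"
        using b(1) pos by (simp add: pos_le_divide_eq mult_ac)
      moreover have "(real m ^ Suc r - real (m - w) ^ Suc r) / (real w * real (Suc r)) \<le> real m ^ r"
        using b(2) pos by (simp add: pos_divide_le_eq mult_ac)
      moreover have "0 \<le> D (m - w) \<and> D (m - w) \<le> real (m - w) ^ r"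
        using less.IH[of "m - w"] w False by simp
      ultimately show ?thesis using D by linarith
    qed
  qed
  then show "0 \<le> D m" "D m \<le> real m ^ r" by auto
qed

section \<open>Counting solutions of the weighted equation\<close>

lemma wsum_ge_elements: "x \<in> set xs \<Longrightarrow> x \<le> wsum xs"
  by (induction xs) (auto intro: trans_le_add1 trans_le_add2)

lemma finite_wpairs: "finite (wpairs a b m)"
proof (rule finite_subset)
  show "wpairs a b m \<subseteq> {x. set x \<subseteq> {..m} \<and> length x = a} \<times> {x. set x \<subseteq> {..m} \<and> length x = b}"
    by (auto simp: wpairs_def dest!: wsum_ge_elements)
qed (intro finite_cartesian_product finite_lists_length_eq; simp)

lemma card_wpairs_commute: "card (wpairs a b m) = card (wpairs b a m)"
proof -
  have "wpairs b a m = prod.swap ` wpairs a b m"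
    by (force simp: wpairs_def)
  then show ?thesis by (simp add: card_image)
qed

text \<open>Solutions are sorted by the value \<open>t\<close> of their first unknown, whose weight
  is \<open>Suc a\<close>.\<close>

lemma card_wpairs_Suc:
  "card (wpairs (Suc a) b m) = (\<Sum>t\<le>m div Suc a. card (wpairs a b (m - Suc a * t)))"
proof -
  let ?f = "\<lambda>t (x, y). (t # x, y)"
  have "wpairs (Suc a) b m = (\<Union>t\<le>m div Suc a. ?f t ` wpairs a b (m - Suc a * t))" (is "?L = ?R")
  proof
    show "?L \<subseteq> ?R"
    proof
      fix p assume "p \<in> ?L"
      then obtain t x y where p: "p = (t # x, y)" "length x = a" "length y = b"
          "t * Suc a + wsum x + wsum y = m"
        by (auto simp: wpairs_def length_Suc_conv)
      then have "t \<le> m div Suc a" by (simp add: less_eq_div_iff_mult_less_eq)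
      moreover have "(x, y) \<in> wpairs a b (m - Suc a * t)"
        using p by (auto simp: wpairs_def)
      ultimately show "p \<in> ?R" using p(1) by force
    qed
    show "?R \<subseteq> ?L"
    proof
      fix p assume "p \<in> ?R"
      then obtain t x y where p: "p = (t # x, y)" "t \<le> m div Suc a" "(x, y) \<in> wpairs a b (m - Suc a * t)"
        by auto
      then have "t * Suc a \<le> m" by (simp add: less_eq_div_iff_mult_less_eq)
      then show "p \<in> ?L" using p by (auto simp: wpairs_def mult.commute)
    qed
  qed
  also have "card \<dots> = (\<Sum>t\<le>m div Suc a. card (?f t ` wpairs a b (m - Suc a * t)))"
    by (rule card_UN_disjoint) (auto simp: finite_wpairs)
  also have "\<dots> = (\<Sum>t\<le>m div Suc a. card (wpairs a b (m - Suc a * t)))"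
    by (intro sum.cong refl card_image) (auto simp: inj_on_def)
  finally show ?thesis .
qed

text \<open>The factor \<open>a + b - 1\<close> makes the estimate exact for \<open>a + b = 1\<close>, where the
  truncated exponent \<open>a + b - 2\<close> would be wrong.\<close>

definition wpairs_estimate :: "nat \<Rightarrow> nat \<Rightarrow> bool" where
  "wpairs_estimate a b \<longleftrightarrow> (\<exists>C\<ge>0. \<forall>m.
     \<bar>real (card (wpairs a b m)) - real m ^ (a + b - 1) / (fact (a + b - 1) * fact a * fact b)\<bar>
       \<le> C * real (a + b - 1) * (real m + 1) ^ (a + b - 2))"

lemma wpairs_estimate_commute: "wpairs_estimate a b \<Longrightarrow> wpairs_estimate b a"
  by (simp add: wpairs_estimate_def card_wpairs_commute[of a b] add.commute mult_ac)

text \<open>The induction starts at one unknown of weight 1, where the count is always 1. Without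
  unknowns the estimate fails, since \<open>a + b - 1\<close> is truncated.\<close>

lemma wpairs_estimate_1_0: "wpairs_estimate 1 0"
proof -
  have "wpairs 1 0 m = {([m], [])}" for m
    by (auto simp: wpairs_def length_Suc_conv)
  then show ?thesis by (auto simp: wpairs_estimate_def intro: exI[of _ 0])
qed

text \<open>Summing the estimate over the new unknown turns the main term into a power sum of step
  \<open>Suc a\<close>, which contributes the factor \<open>1 / (Suc a * Suc r)\<close>; at most
  \<open>m + 1\<close> error terms raise the error exponent by one.\<close>

lemma wpairs_estimate_Suc:
  assumes "wpairs_estimate a b" "a + b \<ge> 1"
  shows "wpairs_estimate (Suc a) b"
proof -
  obtain r where r: "a + b = Suc r" using assms(2) by (cases "a + b") auto
  define L :: real where "L = 1 / (fact r * fact a * fact b)"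
  obtain C where C: "C \<ge> 0" and est: "\<bar>real (card (wpairs a b m)) - L * real m ^ r\<bar>
      \<le> C * real r * (real m + 1) ^ (r - 1)" for m
    using assms(1) unfolding wpairs_estimate_def r L_def by (auto simp: numeral_2_eq_2)
  have L: "0 \<le> L" by (simp add: L_def)
  have "\<bar>real (card (wpairs (Suc a) b m)) - L / (real (Suc a) * real (Suc r)) * real m ^ Suc r\<bar>
      \<le> (C * real r + L) * real (Suc r) * (real m + 1) ^ r" for m
  proof -
    let ?e = "\<lambda>j. real (card (wpairs a b j)) - L * real j ^ r"
    let ?S = "\<Sum>t\<le>m div Suc a. real (m - Suc a * t) ^ r"
    let ?I = "real m ^ Suc r / (real (Suc a) * real (Suc r))"
    have "\<bar>\<Sum>t\<le>m div Suc a. ?e (m - Suc a * t)\<bar> \<le> (\<Sum>t\<le>m div Suc a. \<bar>?e (m - Suc a * t)\<bar>)"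
      by (rule sum_abs)
    also have "\<dots> \<le> (\<Sum>t\<le>m div Suc a. C * real r * (real m + 1) ^ (r - 1))"
    proof (rule sum_mono)
      fix t
      have "\<bar>?e (m - Suc a * t)\<bar> \<le> C * real r * (real (m - Suc a * t) + 1) ^ (r - 1)"
        by (rule est)
      also have "\<dots> \<le> C * real r * (real m + 1) ^ (r - 1)"
        using C by (intro mult_left_mono power_mono) auto
      finally show "\<bar>?e (m - Suc a * t)\<bar> \<le> C * real r * (real m + 1) ^ (r - 1)" .
    qed
    also have "\<dots> = real (m div Suc a + 1) * (C * real r * (real m + 1) ^ (r - 1))"
      by simp
    also have "\<dots> \<le> (real m + 1) * (C * real r * (real m + 1) ^ (r - 1))"
      using C div_le_dividend[of m "Suc a"] by (intro mult_right_mono) auto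
    \<comment> \<open>For \<open>r = 0\<close>, where \<open>r - 1\<close> is truncated, the factor
      \<open>real r\<close> makes both sides vanish.\<close>
    also have "\<dots> = C * real r * (real m + 1) ^ r"
      by (cases r) auto
    finally have 1: "\<bar>\<Sum>t\<le>m div Suc a. ?e (m - Suc a * t)\<bar> \<le> C * real r * (real m + 1) ^ r" .
    have "0 \<le> ?S - ?I" "?S - ?I \<le> real m ^ r"
      using arith_progression_power_sum_bounds[of "Suc a" m r] by auto
    moreover have "real m ^ r \<le> (real m + 1) ^ r" by (intro power_mono) auto
    ultimately have "\<bar>?S - ?I\<bar> \<le> (real m + 1) ^ r" by linarith
    then have 2: "\<bar>L * (?S - ?I)\<bar> \<le> L * (real m + 1) ^ r"
      using L by (simp add: abs_mult mult_left_mono)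
    have "real (card (wpairs (Suc a) b m)) - L / (real (Suc a) * real (Suc r)) * real m ^ Suc r
        = (\<Sum>t\<le>m div Suc a. ?e (m - Suc a * t)) + L * (?S - ?I)"
      by (simp add: card_wpairs_Suc sum_subtractf sum_distrib_left right_diff_distrib)
    then have "\<bar>real (card (wpairs (Suc a) b m)) - L / (real (Suc a) * real (Suc r)) * real m ^ Suc r\<bar>
        \<le> (C * real r + L) * (real m + 1) ^ r"
      using 1 2 by (simp add: distrib_right)
    \<comment> \<open>The factor \<open>Suc r\<close> is inserted to match the shape of the error
      term in \<open>wpairs_estimate\<close>.\<close>
    also have "\<dots> * 1 \<le> (C * real r + L) * (real m + 1) ^ r * real (Suc r)"
      using C L by (intro mult_left_mono) auto
    finally show ?thesis by (simp add: mult_ac)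
  qed
  moreover have "L / (real (Suc a) * real (Suc r)) * real m ^ Suc r =
      real m ^ Suc r / (fact (Suc r) * fact (Suc a) * fact b)" for m
    by (simp add: L_def mult_ac)
  moreover have "0 \<le> C * real r + L" using C L by simp
  ultimately show ?thesis
    unfolding wpairs_estimate_def by (auto simp: r numeral_2_eq_2 simp del: fact_Suc power_Suc of_nat_Suc)
qed

text \<open>Unknowns are added on the left only; the start \<open>a = 0\<close> for positive
  \<open>b\<close> comes from swapping the two sides.\<close>

lemma wpairs_estimate:
  assumes "a + b \<ge> 1"
  shows "wpairs_estimate a b"
proof -
  have 0: "wpairs_estimate (Suc n) 0" for n
    by (induction n) (use wpairs_estimate_1_0 in \<open>auto intro: wpairs_estimate_Suc\<close>)
  show ?thesis
  proof (cases b)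
    case 0
    then show ?thesis using assms \<open>\<And>n. wpairs_estimate (Suc n) 0\<close> by (cases a) auto
  next
    case (Suc b')
    show ?thesis unfolding Suc
      by (induction a) (auto intro: wpairs_estimate_Suc wpairs_estimate_commute 0)
  qed
qed

text \<open>A shift by \<open>c\<close> moves the main term by at most a multiple of
  \<open>n^(k-2)\<close>. The integer exponent makes the bound \<open>1/n\<close> for
  \<open>k = 1\<close>; there the error vanishes for large \<open>n\<close>.\<close>

lemma card_wpairs_shift_bigo:
  assumes k: "k = a + b" "k \<ge> 1"
  shows "(\<lambda>n. real (card (wpairs a b (n - c))) - real n ^ (k - 1) / (fact (k - 1) * fact a * fact b))
     \<in> O(\<lambda>n. real n powi (int k - 2))"
proof -
  define L :: real where "L = 1 / (fact (k - 1) * fact a * fact b)"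
  have L: "0 \<le> L" by (simp add: L_def)
  obtain C where C: "C \<ge> 0" and est: "\<bar>real (card (wpairs a b m)) - L * real m ^ (k - 1)\<bar>
      \<le> C * real (k - 1) * (real m + 1) ^ (k - 2)" for m
    using wpairs_estimate[of a b] k unfolding wpairs_estimate_def L_def by auto
  show ?thesis
  \<comment> \<open>The summands come from the estimate and from the shift, the power of 2 from
    \<open>n + 1 \<le> 2 * n\<close>.\<close>
  proof (rule bigoI[where c = "(C * real (k - 1) + L * real (k - 1) * real c) * 2 ^ (k - 2)"],
      rule eventually_sequentiallyI[of "Suc c"])
    fix n assume n: "Suc c \<le> n"
    have "\<bar>real (card (wpairs a b (n - c))) - L * real n ^ (k - 1)\<bar>
        \<le> (C * real (k - 1) + L * real (k - 1) * real c) * (real n + 1) ^ (k - 2)"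
    proof -
      have "C * real (k - 1) * (real (n - c) + 1) ^ (k - 2) \<le> C * real (k - 1) * (real n + 1) ^ (k - 2)"
        using C by (intro mult_left_mono power_mono) auto
      then have 1: "\<bar>real (card (wpairs a b (n - c))) - L * real (n - c) ^ (k - 1)\<bar>
          \<le> C * real (k - 1) * (real n + 1) ^ (k - 2)"
        using est[of "n - c"] by linarith
      have "real n ^ (k - 1) - real (n - c) ^ (k - 1) \<le> real (k - 1) * real c * real n ^ (k - 2)"
      proof (cases "k = 1")
        case False
        then obtain r where "k = Suc (Suc r)" using k(2) by (metis One_nat_def not0_implies_Suc not_one_le_zero)
        then show ?thesis using power_diff_bounds(2)[of "real (n - c)" "real n" r] n
          by (simp add: of_nat_diff)
      qed auto
      also have "\<dots> \<le> real (k - 1) * real c * (real n + 1) ^ (k - 2)"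
        by (intro mult_left_mono power_mono) auto
      finally have "L * (real n ^ (k - 1) - real (n - c) ^ (k - 1))
          \<le> L * (real (k - 1) * real c * (real n + 1) ^ (k - 2))"
        using L by (intro mult_left_mono)
      moreover have "0 \<le> L * (real n ^ (k - 1) - real (n - c) ^ (k - 1))"
        using L by (intro mult_nonneg_nonneg) (auto intro!: power_mono)
      ultimately show ?thesis using 1 by (simp add: algebra_simps abs_if split: if_splits)
    qed
    also have "\<dots> \<le> (C * real (k - 1) + L * real (k - 1) * real c) * (2 * real n) ^ (k - 2)"
      using C L n by (intro mult_left_mono power_mono) auto
    also have "\<dots> = (C * real (k - 1) + L * real (k - 1) * real c) * 2 ^ (k - 2) * (real n powi (int k - 2))"
    proof (cases "k = 1")
      case False
      then have "int k - 2 = int (k - 2)" using k(2) by simp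
      then show ?thesis by (simp only: power_int_of_nat power_mult_distrib mult.assoc)
    qed auto
    finally show "norm (real (card (wpairs a b (n - c))) - real n ^ (k - 1) / (fact (k - 1) * fact a * fact b))
        \<le> (C * real (k - 1) + L * real (k - 1) * real c) * 2 ^ (k - 2) * norm (real n powi (int k - 2))"
      by (simp add: L_def)
  qed
qed

section \<open>Rows and columns\<close>

lemma length_rows [simp]: "length (rows xs) = length xs"
  by (induction xs) auto

lemma sum_list_map_add: "sum_list (map (\<lambda>i. i + c) xs) = sum_list xs + length xs * (c :: nat)"
  by (induction xs) auto

lemma sum_list_rows: "sum_list (rows xs) = wsum xs"
  by (induction xs) (simp_all add: sum_list_map_add)

lemma sum_list_cols: "sum_list (cols ys) = wsum ys"
  by (induction ys) (auto simp: sum_list_replicate)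

lemma sorted_rows: "sorted_wrt (\<ge>) (rows xs)"
  by (induction xs) (auto simp: sorted_wrt_append sorted_wrt_map)

lemma set_cols: "set (cols ys) \<subseteq> {1..length ys}"
  by (induction ys) auto

lemma sorted_cols: "sorted_wrt (\<ge>) (cols ys)"
proof (induction ys)
  case (Cons y ys)
  have "sorted_wrt (\<ge>) (replicate y n)" for n :: nat by (induction y) auto
  then show ?case using Cons set_cols[of ys] by (auto simp: sorted_wrt_append)
qed auto

text \<open>The last entry is the first unknown; subtracting it from the others leaves a shorter
  decreasing list.\<close>

lemma rows_surj:
  assumes "sorted_wrt (\<ge>) ls"
  shows "\<exists>xs. length xs = length ls \<and> rows xs = ls"
  using assms
proof (induction "length ls" arbitrary: ls)
  case (Suc n)
  then obtain us t where ls: "ls = us @ [t]" by (cases ls rule: rev_cases) auto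
  have us: "sorted_wrt (\<ge>) us" "\<forall>u\<in>set us. u \<ge> t"
    using Suc.prems by (auto simp: ls sorted_wrt_append)
  have "sorted_wrt (\<ge>) (map (\<lambda>u. u - t) us)"
    using us(1) unfolding sorted_wrt_map by (rule sorted_wrt_mono_rel[rotated]) auto
  then obtain xs where xs: "length xs = length us" "rows xs = map (\<lambda>u. u - t) us"
    using Suc.hyps(1)[of "map (\<lambda>u. u - t) us"] Suc.hyps(2) ls by auto
  have "map (\<lambda>i. i + t) (map (\<lambda>u. u - t) us) = us"
    using us(2) by (auto simp: o_def intro!: map_idI)
  then show ?case using xs ls by (intro exI[of _ "t # xs"]) simp
qed auto

text \<open>In a decreasing list the copies of \<open>Suc b\<close> come first; their number is the
  first unknown.\<close>

lemma cols_surj: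
  assumes "sorted_wrt (\<ge>) ls" "set ls \<subseteq> {1..b}"
  shows "\<exists>ys. length ys = b \<and> cols ys = ls"
  using assms
proof (induction b arbitrary: ls)
  case (Suc b)
  let ?p = "takeWhile (\<lambda>u. u = Suc b) ls" and ?q = "dropWhile (\<lambda>u. u = Suc b) ls"
  have pq: "ls = ?p @ ?q" by simp
  have sq: "sorted_wrt (\<ge>) ?q"
    using Suc.prems(1) by (subst (asm) pq) (simp only: sorted_wrt_append)
  have "set ?q \<subseteq> {1..b}"
  proof (cases ?q)
    case (Cons u us)
    then have "u \<noteq> Suc b" using hd_dropWhile[of "\<lambda>u. u = Suc b" ls] by auto
    moreover have "set ?q \<subseteq> {1..Suc b}" using Suc.prems(2) set_dropWhileD by fastforce
    moreover have "\<forall>v\<in>set us. v \<le> u" using sq Cons by simp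
    ultimately show ?thesis using Cons by fastforce
  next
    case Nil
    then show ?thesis by (simp only: list.set) simp
  qed
  with sq Suc.IH obtain ys where ys: "length ys = b" "cols ys = ?q" by blast
  have "?p = replicate (length ?p) (Suc b)"
    by (rule replicate_eqI) (auto dest: set_takeWhileD)
  then show ?case using ys pq by (intro exI[of _ "length ?p # ys"]) simp
qed auto

lemma rows_inj: "length xs = length xs' \<Longrightarrow> rows xs = rows xs' \<Longrightarrow> xs = xs'"
proof (induction xs arbitrary: xs')
  case (Cons x xs)
  then obtain x' us where us: "xs' = x' # us" by (cases xs') auto
  have "x = x'" "map (\<lambda>i. i + x) (rows xs) = map (\<lambda>i. i + x') (rows us)"
    using Cons.prems(2) us by auto
  then have "rows xs = rows us"
    by (metis (mono_tags, lifting) add_right_cancel injI inj_map_eq_map)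
  then show ?case using Cons us \<open>x = x'\<close> by simp
qed auto

lemma cols_inj: "length ys = length ys' \<Longrightarrow> cols ys = cols ys' \<Longrightarrow> ys = ys'"
proof (induction ys arbitrary: ys')
  case (Cons y ys)
  then obtain y' us where us: "ys' = y' # us" by (cases ys') auto
  have notin: "Suc (length vs) \<notin> set (cols vs)" for vs using set_cols[of vs] by auto
  \<comment> \<open>The first unknown is recovered as the multiplicity of the largest admissible
    part.\<close>
  have cnt: "count_list (cols (z # zs)) (Suc (length zs)) = z" for z zs
    using notin[of zs] by (induction z) (auto simp: count_list_0_iff)
  have "y = y'" using cnt[of y ys] cnt[of y' us] Cons.prems us by (metis length_Cons nat.inject)
  then show ?case using Cons us by simp
qed auto

text \<open>Entry \<open>i\<close> is the sum of the first \<open>length xs - i\<close>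
  unknowns.\<close>

lemma rows_nth_ge:
  "\<forall>x\<in>set xs. x \<ge> c \<Longrightarrow> i < length xs \<Longrightarrow> rows xs ! i \<ge> c * (length xs - i)"
proof (induction xs arbitrary: i)
  case (Cons x xs)
  show ?case
  proof (cases "i < length xs")
    case True
    then have "rows xs ! i \<ge> c * (length xs - i)" using Cons by auto
    then show ?thesis using Cons.prems True by (simp add: nth_append Suc_diff_le)
  next
    case False
    then have "i = length xs" using Cons.prems by simp
    then show ?thesis using Cons.prems by (simp add: nth_append)
  qed
qed auto

text \<open>Every part size from \<open>length ys\<close> down to 1 occurs, so the entries descend
  by at most 1 at a time.\<close>

lemma cols_nth_ge:
  "\<forall>y\<in>set ys. y \<ge> 1 \<Longrightarrow> i < length ys \<Longrightarrow> i < length (cols ys) \<and> cols ys ! i \<ge> length ys - i"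
proof (induction ys arbitrary: i)
  case (Cons y ys)
  show ?case
  proof (cases "i < y")
    case True
    then show ?thesis by (simp add: nth_append)
  next
    case False
    moreover have "i - y < length ys" using False Cons.prems by auto
    then have "i - y < length (cols ys) \<and> cols ys ! (i - y) \<ge> length ys - (i - y)"
      using Cons.IH[of "i - y"] Cons.prems by simp
    moreover have "y \<ge> 1" using Cons.prems by simp
    ultimately show ?thesis by (simp add: nth_append) linarith
  qed
qed auto

text \<open>The increment is twice the sum of the weights 1 up to \<open>length xs\<close>.\<close>

lemma wsum_map_add: "wsum (map (\<lambda>x. x + 2) xs) = wsum xs + length xs * Suc (length xs)"
  by (induction xs) (auto simp: algebra_simps)

section \<open>Decomposition of partitions with given Durfee triangle\<close>

definition assemble :: "nat \<Rightarrow> nat list \<times> nat list \<Rightarrow> nat list" where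
  "assemble b = (\<lambda>(x, y). map (\<lambda>i. i + b) (rows x) @ cols y)"

text \<open>For \<open>a \<le> k\<close>, row \<open>Suc a\<close> is the first one at which the
  triangle of size \<open>k + 1\<close> fails to fit.\<close>

definition durfee_class :: "nat \<Rightarrow> nat \<Rightarrow> nat \<Rightarrow> nat list set" where
  "durfee_class k a n = {xs \<in> partitions n. fits_triangle xs k \<and>
     (\<forall>j\<in>{1..a}. part xs j > k + 1 - j) \<and> part xs (Suc a) \<le> k - a}"

lemma durfee_class_part:
  assumes "xs \<in> durfee_class k a n" "i < a"
  shows "k - i < part xs (Suc i)"
proof -
  have "Suc i \<in> {1..a}" using assms(2) by simp
  then have "k + 1 - Suc i < part xs (Suc i)" using assms(1) unfolding durfee_class_def by blast
  then show ?thesis by simp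
qed

lemma fits_triangle_mono:
  assumes "fits_triangle xs m" "l \<le> m"
  shows "fits_triangle xs l"
  unfolding fits_triangle_def
proof
  fix j assume "j \<in> {1..l}"
  then have "m - j < part xs j" using assms by (simp add: fits_triangle_def)
  then show "l - j < part xs j" using assms(2) by linarith
qed

lemma durfee_triangle_size_eq_iff':
  "durfee_triangle_size xs = k \<longleftrightarrow> fits_triangle xs k \<and> \<not> fits_triangle xs (Suc k)"
  unfolding durfee_triangle_size_eq_iff
  by (meson fits_triangle_mono not_less_eq_eq order_refl)

lemma durfee_classes_Union:
  "{xs \<in> partitions n. durfee_triangle_size xs = k} = (\<Union>a\<le>k. durfee_class k a n)"
proof (intro equalityI subsetI)
  fix xs assume "xs \<in> {xs \<in> partitions n. durfee_triangle_size xs = k}"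
  then have xs: "xs \<in> partitions n" "fits_triangle xs k" and "\<not> fits_triangle xs (Suc k)"
    by (auto simp: durfee_triangle_size_eq_iff')
  then obtain j where "j \<in> {1..Suc k}" "part xs j \<le> Suc k - j"
    by (auto simp: fits_triangle_def not_less)
  then have ex: "j - 1 \<le> k \<and> part xs (Suc (j - 1)) \<le> k - (j - 1)" by auto
  define a where "a = (LEAST a. a \<le> k \<and> part xs (Suc a) \<le> k - a)"
  have a: "a \<le> k \<and> part xs (Suc a) \<le> k - a"
    unfolding a_def using ex by (rule LeastI)
  have "part xs j > k + 1 - j" if "j \<in> {1..a}" for j
    \<comment> \<open>Row \<open>j\<close> corresponds to the candidate \<open>j - 1\<close>, which
      is below the minimum \<open>a\<close>.\<close>
    using not_less_Least[of "j - 1" "\<lambda>a. a \<le> k \<and> part xs (Suc a) \<le> k - a"] that a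
    by (auto simp: a_def[symmetric] not_le)
  then have "xs \<in> durfee_class k a n"
    using a xs by (simp add: durfee_class_def)
  then show "xs \<in> (\<Union>a\<le>k. durfee_class k a n)" using a by auto
next
  fix xs assume "xs \<in> (\<Union>a\<le>k. durfee_class k a n)"
  then obtain a where a: "a \<le> k" "xs \<in> durfee_class k a n" by auto
  then have "\<not> fits_triangle xs (Suc k)"
    by (auto simp: durfee_class_def fits_triangle_def not_less intro!: bexI[of _ "Suc a"])
  then show "xs \<in> {xs \<in> partitions n. durfee_triangle_size xs = k}"
    using a by (auto simp: durfee_class_def durfee_triangle_size_eq_iff')
qed

text \<open>Row \<open>Suc a\<close> is at most \<open>k - a\<close> in the first class and larger
  in the second.\<close>

lemma durfee_class_disjoint:
  assumes "a < a'" shows "durfee_class k a n \<inter> durfee_class k a' n = {}"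
proof -
  have "xs \<notin> durfee_class k a' n" if "xs \<in> durfee_class k a n" for xs
    using that durfee_class_part[of xs k a' n a] assms by (auto simp: durfee_class_def)
  then show ?thesis by auto
qed

lemma finite_durfee_class: "finite (durfee_class k a n)"
  using finite_partitions by (auto simp: durfee_class_def)

lemma R_eq_sum_durfee_class: "R k n = (\<Sum>a\<le>k. card (durfee_class k a n))"
  unfolding R_def durfee_classes_Union
proof (rule card_UN_disjoint)
  show "\<forall>i\<in>{..k}. \<forall>j\<in>{..k}. i \<noteq> j \<longrightarrow> durfee_class k i n \<inter> durfee_class k j n = {}"
    by (metis durfee_class_disjoint inf_commute nat_neq_iff)
qed (auto simp: finite_durfee_class)

text \<open>The prescribed lengths fix where the assembled list splits into rows and
  columns.\<close>

lemma assemble_inj: "inj_on (assemble b) (wpairs a c m)"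
proof (rule inj_onI, clarify)
  fix x y x' y'
  assume "(x, y) \<in> wpairs a c m" "(x', y') \<in> wpairs a c m" "assemble b (x, y) = assemble b (x', y')"
  then have l: "length x = length x'" "length y = length y'"
    and "map (\<lambda>i. i + b) (rows x) = map (\<lambda>i. i + b) (rows x')" and "cols y = cols y'"
    by (auto simp: wpairs_def assemble_def)
  moreover from this have "rows x = rows x'"
    by (metis (mono_tags, lifting) add_right_cancel injI inj_map_eq_map)
  ultimately show "x = x' \<and> y = y'" using rows_inj cols_inj by blast
qed

lemma sum_list_assemble:
  "sum_list (assemble b (x, y)) = length x * b + wsum x + wsum y"
  by (simp add: assemble_def sum_list_map_add sum_list_rows sum_list_cols)

text \<open>The first \<open>a\<close> rows exceed \<open>k - a\<close> and all later ones are at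
  most \<open>k - a\<close>, so cutting after row \<open>a\<close> exposes the rectangle, the row
  arms and the parts below.\<close>

lemma durfee_class_subset:
  assumes "a \<le> k"
  shows "durfee_class k a n \<subseteq> assemble (k - a) ` wpairs a (k - a) (n - a * (k - a))"
proof
  fix ls assume ls: "ls \<in> durfee_class k a n"
  define b where "b = k - a"
  have srt: "sorted_wrt (\<ge>) ls" and pos: "\<forall>x\<in>set ls. x \<ge> 1" and sum: "sum_list ls = n"
    using ls by (auto simp: durfee_class_def partitions_def)
  have len: "a \<le> length ls"
    using ls assms fits_triangle_le_length[of ls k] by (auto simp: durfee_class_def)
  let ?h = "take a ls" and ?t = "drop a ls"
  have "sorted_wrt (\<ge>) (?h @ ?t)" using srt by simp
  then have st: "sorted_wrt (\<ge>) ?h" "sorted_wrt (\<ge>) ?t" unfolding sorted_wrt_append by auto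
  have hb: "\<forall>u\<in>set ?h. u \<ge> b"
  proof
    fix u assume "u \<in> set ?h"
    then obtain i where i: "i < a" "u = ls ! i" by (auto simp: in_set_conv_nth)
    moreover have "part ls (Suc i) > k + 1 - Suc i"
      using durfee_class_part[OF ls i(1)] by simp
    ultimately show "u \<ge> b" using len assms by (auto simp: part_def b_def)
  qed
  have "sorted_wrt (\<ge>) (map (\<lambda>u. u - b) ?h)"
    using st(1) unfolding sorted_wrt_map by (rule sorted_wrt_mono_rel[rotated]) auto
  then obtain x where x: "length x = a" "rows x = map (\<lambda>u. u - b) ?h"
    using rows_surj len by fastforce
  have "set ?t \<subseteq> {1..b}"
  proof (cases ?t)
    case (Cons u us)
    then have "a < length ls" "ls ! a = u"
      by (metis drop_eq_Nil2 linorder_not_less list.distinct(1), metis hd_drop_conv_nth drop_eq_Nil2 linorder_not_less list.distinct(1) list.sel(1))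
    then have "u \<le> b" using ls by (auto simp: durfee_class_def part_def b_def)
    moreover have "\<forall>v\<in>set us. v \<le> u" using st(2) Cons by simp
    ultimately have "\<forall>v\<in>set ?t. v \<le> b" using Cons by auto
    then show ?thesis using pos by (auto dest: in_set_dropD)
  qed auto
  then obtain y where y: "length y = b" "cols y = ?t" using cols_surj st(2) by blast
  have "map (\<lambda>i. i + b) (map (\<lambda>u. u - b) ?h) = ?h"
    using hb by (auto simp: o_def intro!: map_idI)
  then have eq: "assemble b (x, y) = ls" by (simp add: assemble_def x y)
  then have "(x, y) \<in> wpairs a b (n - a * b)"
    using sum_list_assemble[of b x y] x y sum by (auto simp: wpairs_def)
  then show "ls \<in> assemble (k - a) ` wpairs a (k - a) (n - a * (k - a))"
    using eq unfolding b_def by force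
qed

text \<open>Once all row differences and column multiplicities are at least 2, the assembled
  partition contains the required staircase automatically.\<close>

lemma assemble_in_durfee_class:
  assumes "a + b = k" "length x = a" "length y = b" "\<forall>u\<in>set x. u \<ge> 2" "\<forall>u\<in>set y. u \<ge> 2"
    and "sum_list (assemble b (x, y)) = n"
  shows "assemble b (x, y) \<in> durfee_class k a n"
proof -
  let ?l = "assemble b (x, y)"
  have part_row: "part ?l j > k + 1 - j" if "j \<in> {1..a}" for j
  proof -
    have "part ?l j = rows x ! (j - 1) + b"
      using that assms by (auto simp: part_def assemble_def nth_append)
    \<comment> \<open>Twice \<open>a - (j - 1)\<close> plus \<open>b\<close> is
      \<open>k + 1 - j\<close> plus the positive number \<open>a - (j - 1)\<close>, which gives the
      strict inequality.\<close>
    moreover have "rows x ! (j - 1) \<ge> 2 * (a - (j - 1))"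
      using rows_nth_ge[of x 2 "j - 1"] that assms by auto
    ultimately show ?thesis using that assms(1) by auto
  qed
  have part_col: "part ?l j > k - j" if "a < j" "j \<le> k" for j
  proof -
    \<comment> \<open>The lower bound \<open>b - (j - 1 - a)\<close> equals
      \<open>k - j + 1\<close>.\<close>
    have c: "j - 1 - a < length (cols y) \<and> cols y ! (j - 1 - a) \<ge> b - (j - 1 - a)"
      using cols_nth_ge[of y "j - 1 - a"] that assms by fastforce
    then have "part ?l j = cols y ! (j - 1 - a)"
      using that assms by (auto simp: part_def assemble_def nth_append)
    then show ?thesis using c that assms(1) by auto
  qed
  have "fits_triangle ?l k"
    unfolding fits_triangle_def
  proof
    fix j assume "j \<in> {1..k}"
    then show "part ?l j > k - j"
      using part_row[of j] part_col[of j] by (cases "j \<le> a") auto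
  qed
  \<comment> \<open>This row is the largest column part, at most \<open>b\<close>, or the padding
    value 0.\<close>
  moreover have "part ?l (Suc a) \<le> k - a"
  proof (cases "cols y")
    case (Cons u us)
    then show ?thesis
      using set_cols[of y] assms by (auto simp: part_def assemble_def nth_append)
  qed (use assms in \<open>simp add: part_def assemble_def\<close>)
  moreover have "?l \<in> partitions n"
  proof -
    have "sorted_wrt (\<ge>) (map (\<lambda>i. i + b) (rows x))"
      using sorted_rows[of x] by (simp add: sorted_wrt_map)
    then have "sorted_wrt (\<ge>) ?l"
      using sorted_cols[of y] set_cols[of y] assms(3)
      by (fastforce simp: assemble_def sorted_wrt_append)
    moreover have "u \<ge> 1" if "u \<in> set (rows x)" for u
    proof -
      obtain i where "i < a" "u = rows x ! i" using \<open>u \<in> set (rows x)\<close> assms(2) by (auto simp: in_set_conv_nth)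
      then show ?thesis using rows_nth_ge[of x 2 i] assms by auto
    qed
    then have "\<forall>u\<in>set ?l. u \<ge> 1"
      using set_cols[of y] by (fastforce simp: assemble_def)
    ultimately show ?thesis using assms(6) by (simp add: partitions_def)
  qed
  ultimately show ?thesis using part_row by (simp add: durfee_class_def)
qed

section \<open>Asymptotics of the classes and of their sum\<close>

lemma card_durfee_class_upper:
  assumes "a \<le> k"
  shows "card (durfee_class k a n) \<le> card (wpairs a (k - a) (n - a * (k - a)))"
  using surj_card_le[OF finite_wpairs durfee_class_subset[OF assms]] .

text \<open>Raising all unknowns by 2 embeds the solutions into the class. The shift
  \<open>c\<close> consists of the rectangle \<open>a * b\<close> and the weight
  \<open>a * Suc a + b * Suc b\<close> that the raising adds.\<close>

lemma card_durfee_class_lower: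
  fixes k a :: nat
  assumes "a \<le> k"
  defines "b \<equiv> k - a"
  defines "c \<equiv> a * b + a * Suc a + b * Suc b"
  assumes "c \<le> n"
  shows "card (wpairs a b (n - c)) \<le> card (durfee_class k a n)"
proof (rule card_inj_on_le)
  let ?s = "\<lambda>(x, y). (map (\<lambda>u. u + 2) x, map (\<lambda>u. u + (2::nat)) y)"
  have sub: "?s ` wpairs a b (n - c) \<subseteq> wpairs a b (n - a * b)"
    using assms(4) by (auto simp: wpairs_def wsum_map_add c_def simp del: add_2_eq_Suc')
  have "inj_on ?s (wpairs a b (n - c))"
    by (auto simp: inj_on_def dest!: map_injective intro!: injI)
  then show "inj_on (assemble b \<circ> ?s) (wpairs a b (n - c))"
    by (rule comp_inj_on) (rule inj_on_subset[OF assemble_inj sub])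
  show "(assemble b \<circ> ?s) ` wpairs a b (n - c) \<subseteq> durfee_class k a n"
  proof (rule image_subsetI)
    fix p assume "p \<in> wpairs a b (n - c)"
    then obtain x y where p: "p = (x, y)" and len: "length x = a" "length y = b"
        and "wsum x + wsum y = n - c"
      by (auto simp: wpairs_def)
    then have "sum_list (assemble b (?s p)) = n"
      using assms(4) by (simp add: sum_list_assemble wsum_map_add c_def del: add_2_eq_Suc')
    then show "(assemble b \<circ> ?s) p \<in> durfee_class k a n"
      using assemble_in_durfee_class[of a b k "map (\<lambda>u. u + 2) x" "map (\<lambda>u. u + 2) y" n]
        assms(1) len
      by (simp add: p b_def)
  qed
qed (rule finite_durfee_class)

text \<open>The class is squeezed between two solution counts whose shifts \<open>a * b\<close> and
  \<open>c\<close> do not depend on \<open>n\<close>; both have the same main term.\<close>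

lemma card_durfee_class_bigo:
  assumes "a \<le> k" "k \<ge> 1"
  shows "(\<lambda>n. real (card (durfee_class k a n)) - real n ^ (k - 1) / (fact (k - 1) * fact a * fact (k - a)))
     \<in> O(\<lambda>n. real n powi (int k - 2))"
proof -
  define b where "b = k - a"
  define c where "c = a * b + a * Suc a + b * Suc b"
  define f where "f = (\<lambda>d n. real (card (wpairs a b (n - d))) - real n ^ (k - 1) / (fact (k - 1) * fact a * fact b))"
  have f: "f d \<in> O(\<lambda>n. real n powi (int k - 2))" for d
    unfolding f_def using assms by (intro card_wpairs_shift_bigo) (auto simp: b_def)
  have "(\<lambda>n. \<bar>f (a * b) n\<bar> + \<bar>f c n\<bar>) \<in> O(\<lambda>n. real n powi (int k - 2))"
    using f by (intro sum_in_bigo) auto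
  moreover have "(\<lambda>n. real (card (durfee_class k a n)) - real n ^ (k - 1) / (fact (k - 1) * fact a * fact b))
     \<in> O(\<lambda>n. \<bar>f (a * b) n\<bar> + \<bar>f c n\<bar>)"
  proof (rule bigoI[where c = 1], rule eventually_sequentiallyI[of c])
    fix n assume "c \<le> n"
    then have "card (wpairs a b (n - c)) \<le> card (durfee_class k a n)"
      using card_durfee_class_lower[OF assms(1)] by (simp add: b_def c_def)
    moreover have "card (durfee_class k a n) \<le> card (wpairs a b (n - a * b))"
      using card_durfee_class_upper[OF assms(1)] by (simp add: b_def)
    ultimately have "real (card (wpairs a b (n - c))) \<le> real (card (durfee_class k a n))"
        "real (card (durfee_class k a n)) \<le> real (card (wpairs a b (n - a * b)))"
      by simp_all
    moreover have "\<bar>y - L\<bar> \<le> 1 * \<bar>\<bar>z - L\<bar> + \<bar>x - L\<bar>\<bar>" if "x \<le> y" "y \<le> z" for x y z L :: real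
      using that by (auto simp: abs_if)
    ultimately show "norm (real (card (durfee_class k a n)) - real n ^ (k - 1) / (fact (k - 1) * fact a * fact b))
        \<le> 1 * norm (\<bar>f (a * b) n\<bar> + \<bar>f c n\<bar>)"
      unfolding f_def real_norm_def by blast
  qed
  ultimately show ?thesis unfolding b_def by (rule landau_o.big_trans[rotated])
qed

theorem theorem2:
  fixes k :: nat
  assumes "k \<ge> 1"
  shows "(\<lambda>n::nat. real (R k n) - 2 ^ k / fact k * (real n ^ (k - 1) / fact (k - 1)))
           \<in> O(\<lambda>n. real n powi (int k - 2))"
proof -
  \<comment> \<open>The binomial row sum, divided by \<open>fact k\<close>, adds up the leading
    coefficients of the classes.\<close>
  have "2 ^ k = (\<Sum>a\<le>k. real (k choose a))"
    using choose_row_sum[of k] by (metis of_nat_numeral of_nat_power of_nat_sum)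
  also have "\<dots> = (\<Sum>a\<le>k. fact k / (fact a * fact (k - a)))"
    by (intro sum.cong) (auto simp: binomial_fact)
  finally have s: "2 ^ k / fact k = (\<Sum>a\<le>k. 1 / (fact a * fact (k - a) :: real))"
    by (simp add: sum_divide_distrib)
  have "real (R k n) - 2 ^ k / fact k * (real n ^ (k - 1) / fact (k - 1)) =
      (\<Sum>a\<le>k. real (card (durfee_class k a n)) - real n ^ (k - 1) / (fact (k - 1) * fact a * fact (k - a)))" for n
    by (simp add: R_eq_sum_durfee_class s sum_subtractf sum_distrib_left sum_divide_distrib mult_ac)
  moreover have "(\<lambda>n. \<Sum>a\<le>k. real (card (durfee_class k a n)) -
      real n ^ (k - 1) / (fact (k - 1) * fact a * fact (k - a))) \<in> O(\<lambda>n. real n powi (int k - 2))"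
    using assms by (intro big_sum_in_bigo card_durfee_class_bigo) simp_all
  ultimately show ?thesis by (simp only:)
qed

end
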